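(* Let $(G,q_1)$ and $(\Gamma,q_2)$ be metric groups with $|G|$ even, $|\Gamma|$ odd, and $c:=\mathcal{G}(q_1)=-\mathcal{G}(q_2)$. Let $S',T',C'$ be the $J\times J$ matrices defined in the context. Then $S'^2=C'$, $(S'T')^3=-cC'$ and $T'C'=C'T'$.
   Context: A metric group $(G,q)$ is a finite abelian group $G$ with a map $q:G\to\mathbb{T}=\{z\in\mathbb{C}:|z|=1\}$ such that $q(-g)=q(g)$ and $\langle g,h\rangle=q(g+h)q(g)^{-1}q(h)^{-1}$ is a non-degenerate bicharacter. $\mathcal{G}(q)=\frac{1}{\sqrt{|G|}}\sum_{g\in G}q(g)$. Let $K=G_2=\{g\in G:2g=0\}$, $a=1/\sqrt{|G|}$, $b=1/\sqrt{|\Gamma|}$. Fix $G_*\subset G$, $\Gamma_*\subset\Gamma$ with $G=K\sqcup G_*\sqcup(-G_* )$, $\Gamma=\{0\}\sqcup\Gamma_*\sqcup(-\Gamma_* )$. Let $J_1=(K\setminus\{0\})\times\{1,-1\}$ and $J=\{0,\pi\}\sqcup J_1\sqcup G_*\sqcup\Gamma_*$. Involution on $J$: $\overline{(k,\varepsilon)}=(k,c^2\langle k,k\rangle\varepsilon)$ for $(k,\varepsilon)\in J_1$ (here $c^2\in\{1,-1\}$), all other elements fixed. With blocks indexed in order by $\{0\},\{\pi\},J_1,G_*,\Gamma_*$ (rows $0,\pi,(k,\varepsilon),g,\gamma$; columns with primes): $$S'=\begin{pmatrix} \frac{-a+b}{2}&\frac{a+b}{2}&\frac{a}{2}&a&b\\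 \frac{a+b}{2}&\frac{-a+b}{2}&\frac{-a}{2}&-a&b\\ \frac{a}{2}&\frac{-a}{2}&-\frac{a\langle k,k'\rangle+c\varepsilon\varepsilon'q_1(k)\delta_{k,k'}}{2}&-a\langle k,g'\rangle&0\\ a&-a&-a\langle g,k'\rangle&-a(\langle g,g'\rangle+\overline{\langle g,g'\rangle})&0\\ b&b&0&0&b(\langle\gamma,\gamma'\rangle+\overline{\langle\gamma,\gamma'\rangle}) \end{pmatrix},$$ $T'=\mathrm{Diag}(1,1,q_1(k),q_1(g),q_2(\gamma))$, and $C'_{x,y}=\delta_{x,\overline y}$. *)

theory Defs
  imports Complex_Main "HOL-Library.Cardinality"
begin

text \<open>Finite abelian groups are types of class \<open>{finite, ab_group_add}\<close>.\<close>

definition bichar :: "('g::ab_group_add \<Rightarrow> complex) \<Rightarrow> 'g \<Rightarrow> 'g \<Rightarrow> complex" where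
  "bichar q g h = q (g + h) * inverse (q g) * inverse (q h)"

definition metric_group :: "('g::{finite, ab_group_add} \<Rightarrow> complex) \<Rightarrow> bool" where
  "metric_group q \<longleftrightarrow>
     (\<forall>g. norm (q g) = 1) \<and>
     (\<forall>g. q (- g) = q g) \<and>
     (\<forall>g h k. bichar q (g + h) k = bichar q g k * bichar q h k) \<and>
     (\<forall>g h k. bichar q g (h + k) = bichar q g h * bichar q g k) \<and>
     (\<forall>g. (\<forall>h. bichar q g h = 1) \<longrightarrow> g = 0)"

definition gauss_sum :: "('g::{finite, ab_group_add} \<Rightarrow> complex) \<Rightarrow> complex" where
  "gauss_sum q = 1 / complex_of_real (sqrt (real CARD('g))) * (\<Sum>g\<in>UNIV. q g)"

definition two_torsion :: "'g::ab_group_add set" where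
  "two_torsion = {g. g + g = 0}"

definition half_system :: "'g::ab_group_add set \<Rightarrow> 'g set \<Rightarrow> bool" where
  "half_system K H \<longleftrightarrow>
     K \<union> H \<union> uminus ` H = UNIV \<and>
     K \<inter> H = {} \<and> K \<inter> uminus ` H = {} \<and> H \<inter> uminus ` H = {}"

text \<open>
  The sign \<open>\<epsilon>\<close> in an index \<open>(k, \<epsilon>)\<close> is kept as a complex number, so that the involution
  \<open>(k, \<epsilon>) \<mapsto> (k, c\<^sup>2 \<langle>k,k\<rangle> \<epsilon>)\<close> can be written literally; membership in
  \<open>idx_set\<close> forces \<open>\<epsilon> \<in> {1, -1}\<close>.
\<close>

datatype ('g, 'h) idx =
    I_zero
  | I_pi
  | I_K 'g complex
  | I_G 'g
  | I_\<Gamma> 'h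

definition idx_set :: "'g::ab_group_add set \<Rightarrow> 'h set \<Rightarrow> ('g, 'h) idx set" where
  "idx_set Gs \<Gamma>s =
     {I_zero, I_pi}
     \<union> {I_K k \<epsilon> | k \<epsilon>. k \<in> two_torsion - {0} \<and> \<epsilon> \<in> {1, - 1}}
     \<union> I_G ` Gs \<union> I_\<Gamma> ` \<Gamma>s"

fun idx_bar :: "('g::ab_group_add \<Rightarrow> complex) \<Rightarrow> complex \<Rightarrow> ('g, 'h) idx \<Rightarrow> ('g, 'h) idx" where
  "idx_bar q1 c (I_K k \<epsilon>) = I_K k (c\<^sup>2 * bichar q1 k k * \<epsilon>)"
| "idx_bar q1 c x = x"

text \<open>
  A matrix indexed by a finite set \<open>J\<close> is a function of two arguments of which only the
  values on \<open>J \<times> J\<close> are meaningful.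
\<close>

definition mat_mult_on ::
    "'j set \<Rightarrow> ('j \<Rightarrow> 'j \<Rightarrow> complex) \<Rightarrow> ('j \<Rightarrow> 'j \<Rightarrow> complex) \<Rightarrow> 'j \<Rightarrow> 'j \<Rightarrow> complex" where
  "mat_mult_on J A B = (\<lambda>x y. \<Sum>z\<in>J. A x z * B z y)"

definition mat_eq_on :: "'j set \<Rightarrow> ('j \<Rightarrow> 'j \<Rightarrow> complex) \<Rightarrow> ('j \<Rightarrow> 'j \<Rightarrow> complex) \<Rightarrow> bool" where
  "mat_eq_on J A B \<longleftrightarrow> (\<forall>x\<in>J. \<forall>y\<in>J. A x y = B x y)"

definition mat_power_on ::
    "'j set \<Rightarrow> ('j \<Rightarrow> 'j \<Rightarrow> complex) \<Rightarrow> nat \<Rightarrow> 'j \<Rightarrow> 'j \<Rightarrow> complex" where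
  "mat_power_on J A n = (mat_mult_on J A ^^ n) (\<lambda>x y. if x = y then 1 else 0)"

definition S_mat ::
    "('g::{finite, ab_group_add} \<Rightarrow> complex) \<Rightarrow> ('h::{finite, ab_group_add} \<Rightarrow> complex) \<Rightarrow> complex
      \<Rightarrow> ('g, 'h) idx \<Rightarrow> ('g, 'h) idx \<Rightarrow> complex" where
  "S_mat q1 q2 c x y =
    (let a = 1 / complex_of_real (sqrt (real CARD('g)));
         b = 1 / complex_of_real (sqrt (real CARD('h)))
     in case x of
       I_zero \<Rightarrow>
         (case y of
            I_zero \<Rightarrow> (- a + b) / 2
          | I_pi \<Rightarrow> (a + b) / 2
          | I_K k' \<epsilon>' \<Rightarrow> a / 2
          | I_G g' \<Rightarrow> a
          | I_\<Gamma> \<gamma>' \<Rightarrow> b)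
     | I_pi \<Rightarrow>
         (case y of
            I_zero \<Rightarrow> (a + b) / 2
          | I_pi \<Rightarrow> (- a + b) / 2
          | I_K k' \<epsilon>' \<Rightarrow> - a / 2
          | I_G g' \<Rightarrow> - a
          | I_\<Gamma> \<gamma>' \<Rightarrow> b)
     | I_K k \<epsilon> \<Rightarrow>
         (case y of
            I_zero \<Rightarrow> a / 2
          | I_pi \<Rightarrow> - a / 2
          | I_K k' \<epsilon>' \<Rightarrow>
              - ((a * bichar q1 k k' + c * \<epsilon> * \<epsilon>' * q1 k * (if k = k' then 1 else 0)) / 2)
          | I_G g' \<Rightarrow> - a * bichar q1 k g'
          | I_\<Gamma> \<gamma>' \<Rightarrow> 0)
     | I_G g \<Rightarrow>
         (case y of
            I_zero \<Rightarrow> a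
          | I_pi \<Rightarrow> - a
          | I_K k' \<epsilon>' \<Rightarrow> - a * bichar q1 g k'
          | I_G g' \<Rightarrow> - a * (bichar q1 g g' + cnj (bichar q1 g g'))
          | I_\<Gamma> \<gamma>' \<Rightarrow> 0)
     | I_\<Gamma> \<gamma> \<Rightarrow>
         (case y of
            I_zero \<Rightarrow> b
          | I_pi \<Rightarrow> b
          | I_K k' \<epsilon>' \<Rightarrow> 0
          | I_G g' \<Rightarrow> 0
          | I_\<Gamma> \<gamma>' \<Rightarrow> b * (bichar q2 \<gamma> \<gamma>' + cnj (bichar q2 \<gamma> \<gamma>'))))"

fun T_diag :: "('g \<Rightarrow> complex) \<Rightarrow> ('h \<Rightarrow> complex) \<Rightarrow> ('g, 'h) idx \<Rightarrow> complex" where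
  "T_diag q1 q2 I_zero = 1"
| "T_diag q1 q2 I_pi = 1"
| "T_diag q1 q2 (I_K k \<epsilon>) = q1 k"
| "T_diag q1 q2 (I_G g) = q1 g"
| "T_diag q1 q2 (I_\<Gamma> \<gamma>) = q2 \<gamma>"

definition T_mat ::
    "('g \<Rightarrow> complex) \<Rightarrow> ('h \<Rightarrow> complex) \<Rightarrow> ('g, 'h) idx \<Rightarrow> ('g, 'h) idx \<Rightarrow> complex" where
  "T_mat q1 q2 x y = (if x = y then T_diag q1 q2 x else 0)"

definition C_mat ::
    "('g::ab_group_add \<Rightarrow> complex) \<Rightarrow> complex \<Rightarrow> ('g, 'h) idx \<Rightarrow> ('g, 'h) idx \<Rightarrow> complex" where
  "C_mat q1 c x y = (if x = idx_bar q1 c y then 1 else 0)"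

end

theory Submission
  imports Defs "HOL-Number_Theory.Cong"
begin

text \<open>
  After an orthogonal change of basis, \<open>S'\<close> is the direct sum of minus the even part of the Weil
  representation of \<open>(G, q\<^sub>1)\<close>, the even part of that of \<open>(\<Gamma>, q\<^sub>2)\<close>, and a diagonal block
  with entries \<open>- c q\<^sub>1(k)\<close> on the vectors \<open>(k, 1) - (k, -1)\<close>. Hence a sum over \<open>J\<close> of products
  of two rows splits into sums over all of \<open>G\<close>, \<open>\<Gamma>\<close> and \<open>K\<close>, which are evaluated by
  orthogonality of characters and by completing the square. This gives \<open>S'\<^sup>2 = C'\<close> and
  \<open>S' T' S' = - c T'\<^sup>-\<^sup>1 S' T'\<^sup>-\<^sup>1\<close>, which imply the relations. On the diagonal block
  one needs \<open>c\<^sup>4 = 1\<close>; this is where \<open>|\<Gamma>|\<close> odd enters.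
\<close>

section \<open>Sums of two squares modulo an odd number\<close>

text \<open>If two squares agree, \<open>p\<close> divides \<open>x - y\<close> or
  \<open>x + y\<close>. Both have absolute value below \<open>p\<close>, so whichever is divisible
  vanishes; \<open>x + y = 0\<close> forces \<open>x = y = 0\<close>.\<close>

lemma inj_on_square_mod_prime:
  fixes p :: int
  assumes "prime p" and "2 * m < p"
  shows "inj_on (\<lambda>x. x\<^sup>2 mod p) {0..m}"
proof (rule inj_onI)
  fix x y assume xy: "x \<in> {0..m}" "y \<in> {0..m}" and "x\<^sup>2 mod p = y\<^sup>2 mod p"
  then have "p dvd x\<^sup>2 - y\<^sup>2" by (simp add: mod_eq_dvd_iff)
  then have "p dvd (x - y) * (x + y)" by (simp add: power2_eq_square algebra_simps)
  then have "p dvd x - y \<or> p dvd x + y" using assms(1) prime_dvd_mult_iff by blast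
  then show "x = y"
  proof
    assume "p dvd x - y"
    then show ?thesis using xy assms(2) zdvd_not_zless[of "\<bar>x - y\<bar>" p] by fastforce
  next
    assume "p dvd x + y"
    then show ?thesis using xy assms(2) zdvd_not_zless[of "x + y" p] by fastforce
  qed
qed

text \<open>Pigeonhole for \<open>p = 2 * m + 1\<close>: the \<open>m + 1\<close> squares and the
  \<open>m + 1\<close> values \<open>- 1 - y\<^sup>2\<close> cannot be disjoint among
  \<open>p\<close> residues.\<close>

lemma prime_dvd_sum_two_squares_plus_one:
  fixes p :: nat
  assumes "prime p"
  shows "\<exists>u v::nat. p dvd u\<^sup>2 + v\<^sup>2 + 1"
proof (cases "p = 2")
  case True
  then have "p dvd 1\<^sup>2 + 0\<^sup>2 + 1" by simp
  then show ?thesis by blast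
next
  case False
  then have "odd p" using assms prime_odd_nat prime_ge_2_nat[OF assms] by force
  then obtain m where m: "p = 2 * m + 1" by (auto elim: oddE)
  define P where "P = int p"
  have "prime P" using assms by (simp add: P_def)
  then have P: "prime P" "P = 2 * int m + 1" "P > 0" using m by (simp_all add: P_def)
  define X where "X = (\<lambda>x. x\<^sup>2 mod P) ` {0..int m}"
  define Y where "Y = (\<lambda>x. (- 1 - x\<^sup>2) mod P) ` {0..int m}"
  have inj: "inj_on (\<lambda>x. x\<^sup>2 mod P) {0..int m}"
    using P by (intro inj_on_square_mod_prime) auto
  have inj': "inj_on (\<lambda>x. (- 1 - x\<^sup>2) mod P) {0..int m}"
  proof (rule inj_onI)
    fix x y assume xy: "x \<in> {0..int m}" "y \<in> {0..int m}"
      and "(- 1 - x\<^sup>2) mod P = (- 1 - y\<^sup>2) mod P"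
    then have "P dvd y\<^sup>2 - x\<^sup>2" by (simp add: mod_eq_dvd_iff)
    then have "y\<^sup>2 mod P = x\<^sup>2 mod P" by (simp add: mod_eq_dvd_iff)
    then show "x = y" using inj xy by (auto dest: inj_onD)
  qed
  have "card X = m + 1" "card Y = m + 1"
    unfolding X_def Y_def using card_image[OF inj] card_image[OF inj'] by simp_all
  moreover have "X \<union> Y \<subseteq> {0..<P}" using P(3) by (auto simp: X_def Y_def)
  then have "card (X \<union> Y) \<le> p" using card_mono[of "{0..<P}"] by (simp add: P_def)
  moreover have "finite X" "finite Y" by (simp_all add: X_def Y_def)
  ultimately have "X \<inter> Y \<noteq> {}" using card_Un_disjoint[of X Y] m by fastforce
  then obtain x y where xy: "x \<ge> 0" "y \<ge> 0" "x\<^sup>2 mod P = (- 1 - y\<^sup>2) mod P"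
    by (auto simp: X_def Y_def)
  then have "P dvd x\<^sup>2 + y\<^sup>2 + 1" by (simp add: mod_eq_dvd_iff algebra_simps)
  then have "int p dvd int ((nat x)\<^sup>2 + (nat y)\<^sup>2 + 1)" using xy by (simp add: P_def ac_simps)
  then show ?thesis using int_dvd_int_iff by blast
qed

text \<open>A Hensel step. Replacing \<open>u\<close> by \<open>u + n * s\<close> turns the cofactor
  \<open>t\<close> into \<open>t + 2 * u * s + n * s\<^sup>2\<close>. The last term is divisible by
  \<open>p\<close> already, and \<open>2 * u\<close> is invertible modulo \<open>p\<close>, so
  \<open>s\<close> can be chosen to make the rest divisible.\<close>

lemma lift_sum_two_squares_plus_one:
  fixes n p u v :: nat
  assumes "prime p" "odd p" "p dvd n" "n dvd u\<^sup>2 + v\<^sup>2 + 1" "\<not> p dvd u"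
  shows "\<exists>u'. n * p dvd u'\<^sup>2 + v\<^sup>2 + 1"
proof -
  obtain t where t: "u\<^sup>2 + v\<^sup>2 + 1 = n * t" using assms(4) by (auto elim: dvdE)
  have "coprime (2 * u) p"
    using assms by (metis coprime_commute coprime_mult_left_iff coprime_left_2_iff_odd prime_imp_coprime)
  from cong_solve_coprime_nat[OF this] obtain x where x: "[2 * u * x = 1] (mod p)"
    by auto
  \<comment> \<open>This is \<open>- t / (2 * u)\<close> modulo \<open>p\<close>, with
    \<open>p - 1\<close> standing for \<open>-1\<close> among natural numbers.\<close>
  define s where "s = x * (t * (p - 1))"
  have "[t + 2 * u * x * (t * (p - 1)) = t + 1 * (t * (p - 1))] (mod p)"
    using x by (intro cong_add cong_mult) auto
  moreover have "t + 1 * (t * (p - 1)) = t * p"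
    using prime_gt_0_nat[OF assms(1)] by (cases p) auto
  ultimately have "[t + 2 * u * s = 0] (mod p)"
    by (simp add: s_def mult.assoc cong_def)
  then have "p dvd t + 2 * u * s" by (simp add: cong_0_iff)
  then have "p dvd t + 2 * u * s + n * s\<^sup>2" using assms(3) by simp
  then have "n * p dvd n * (t + 2 * u * s + n * s\<^sup>2)" by (rule mult_dvd_mono[OF dvd_refl])
  moreover have "n * (t + 2 * u * s + n * s\<^sup>2) = (u + n * s)\<^sup>2 + v\<^sup>2 + 1"
    using t by (simp add: power2_eq_square algebra_simps)
  ultimately show ?thesis by metis
qed

text \<open>One prime factor is added at a time: a repeated prime by the Hensel step, a new prime by
  the Chinese remainder theorem.\<close>

lemma odd_dvd_sum_two_squares_plus_one:
  fixes n :: nat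
  assumes "odd n"
  shows "\<exists>u v::nat. n dvd u\<^sup>2 + v\<^sup>2 + 1"
  using assms
proof (induction n rule: prime_divisors_induct)
  case zero
  then show ?case by simp
next
  case (unit x)
  then show ?case by simp
next
  case (factor p n)
  then obtain u v where uv: "n dvd u\<^sup>2 + v\<^sup>2 + 1" by auto
  have p: "prime p" "odd p" using factor by auto
  show ?case
  proof (cases "p dvd n")
    case True
    \<comment> \<open>The Hensel step needs a square root that is a unit modulo \<open>p\<close>; by
      symmetry either one will do.\<close>
    have "\<not> p dvd u \<or> \<not> p dvd v"
    proof (rule ccontr)
      assume "\<not> ?thesis"
      then have "p dvd u\<^sup>2 + v\<^sup>2" by (simp add: power2_eq_square)
      moreover have "p dvd u\<^sup>2 + v\<^sup>2 + 1" using True uv by (rule dvd_trans)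
      ultimately have "p dvd 1" using dvd_add_right_iff by blast
      then show False using p(1) by simp
    qed
    then show ?thesis
    proof
      assume "\<not> p dvd u"
      then show ?thesis
        using lift_sum_two_squares_plus_one[OF p True uv] by (metis mult.commute)
    next
      assume "\<not> p dvd v"
      moreover have "n dvd v\<^sup>2 + u\<^sup>2 + 1" using uv by (simp add: add.commute)
      ultimately show ?thesis
        using lift_sum_two_squares_plus_one[OF p True] by (metis mult.commute)
    qed
  next
    case False
    then have cop: "coprime p n" using p(1) by (simp add: prime_imp_coprime)
    obtain r s where rs: "p dvd r\<^sup>2 + s\<^sup>2 + 1"
      using prime_dvd_sum_two_squares_plus_one[OF p(1)] by auto
    obtain x where x: "[x = r] (mod p)" "[x = u] (mod n)"
      using binary_chinese_remainder_nat[OF cop] by blast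
    obtain y where y: "[y = s] (mod p)" "[y = v] (mod n)"
      using binary_chinese_remainder_nat[OF cop] by blast
    have "[x\<^sup>2 + y\<^sup>2 + 1 = r\<^sup>2 + s\<^sup>2 + 1] (mod p)" "[x\<^sup>2 + y\<^sup>2 + 1 = u\<^sup>2 + v\<^sup>2 + 1] (mod n)"
      by (intro cong_add cong_pow cong_refl x y)+
    then have "p dvd x\<^sup>2 + y\<^sup>2 + 1" "n dvd x\<^sup>2 + y\<^sup>2 + 1"
      using rs uv by (simp_all add: cong_def dvd_eq_mod_eq_0)
    then show ?thesis using cop divides_mult by blast
  qed
qed

section \<open>Metric groups and Gauss sums\<close>

text \<open>For a metric group this is the bicharacter plus its conjugate, the Fourier kernel on
  even functions. Writing it with \<open>- u\<close> lets products be expanded by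
  bimultiplicativity.\<close>

definition even_bichar :: "('g::ab_group_add \<Rightarrow> complex) \<Rightarrow> 'g \<Rightarrow> 'g \<Rightarrow> complex" where
  "even_bichar q u h = bichar q u h + bichar q (- u) h"

lemma gauss_sum_normalization:
  fixes q :: "'g::{finite, ab_group_add} \<Rightarrow> complex"
  defines "a \<equiv> 1 / complex_of_real (sqrt (real CARD('g)))"
  shows "a * a * of_nat CARD('g) = 1" and "a * (\<Sum>g\<in>UNIV. q g) = gauss_sum q"
proof -
  have "complex_of_real (sqrt (real CARD('g))) * complex_of_real (sqrt (real CARD('g)))
      = of_nat CARD('g)"
    by (metis of_nat_0_le_iff of_real_mult of_real_of_nat_eq real_sqrt_mult_self abs_of_nonneg)
  then show "a * a * of_nat CARD('g) = 1" by (simp add: a_def field_simps)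
  show "a * (\<Sum>g\<in>UNIV. q g) = gauss_sum q" by (simp add: a_def gauss_sum_def)
qed

context
  fixes q :: "'g::{finite, ab_group_add} \<Rightarrow> complex"
  assumes mg: "metric_group q"
begin

lemma metric_group_nonzero: "q g \<noteq> 0"
  using mg unfolding metric_group_def by (metis norm_zero zero_neq_one)

lemma metric_group_minus: "q (- g) = q g"
  using mg unfolding metric_group_def by blast

lemma metric_group_add: "q (g + h) = q g * q h * bichar q g h"
  by (simp add: bichar_def metric_group_nonzero field_simps)

lemma bichar_nonzero: "bichar q g h \<noteq> 0"
  by (simp add: bichar_def metric_group_nonzero)

lemma bichar_add_left: "bichar q (g + h) k = bichar q g k * bichar q h k"
  using mg unfolding metric_group_def by blast

lemma bichar_add_right: "bichar q g (h + k) = bichar q g h * bichar q g k"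
  using mg unfolding metric_group_def by blast

lemma bichar_commute: "bichar q g h = bichar q h g"
  by (simp add: bichar_def add.commute)

lemma bichar_zero_left: "bichar q 0 g = 1"
  using bichar_add_left[of 0 0 g] bichar_nonzero[of 0 g] by simp

lemma bichar_zero_right: "bichar q g 0 = 1"
  using bichar_zero_left bichar_commute by metis

lemma metric_group_zero: "q 0 = 1"
  using metric_group_add[of 0 0] metric_group_nonzero[of 0] bichar_zero_left[of 0] by simp

lemma bichar_minus_left: "bichar q (- g) h = inverse (bichar q g h)"
  using bichar_add_left[of g "- g" h] bichar_zero_left
  by (simp add: inverse_unique)

lemma bichar_minus_right: "bichar q g (- h) = inverse (bichar q g h)"
  using bichar_minus_left bichar_commute by metis

lemma metric_group_diff: "q (g - h) = q g * q h * inverse (bichar q g h)"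
  using metric_group_add[of g "- h"] by (simp add: metric_group_minus bichar_minus_right)

lemma bichar_self: "bichar q g g = (q g)\<^sup>2"
  using metric_group_diff[of g g]
  by (simp add: metric_group_zero bichar_nonzero field_simps power2_eq_square)

lemma cnj_metric_group: "cnj (q g) = inverse (q g)"
proof -
  have "norm (q g) = 1" using mg by (simp add: metric_group_def)
  then have "q g * cnj (q g) = 1" by (simp flip: complex_norm_square)
  then show ?thesis by (simp add: inverse_unique)
qed

lemma cnj_bichar: "cnj (bichar q g h) = bichar q (- g) h"
  unfolding bichar_minus_left by (simp add: bichar_def cnj_metric_group)

lemma bichar_two_torsion:
  assumes "k \<in> two_torsion"
  shows "(bichar q k g)\<^sup>2 = 1"
  using assms bichar_add_left[of k k g]
  by (simp add: two_torsion_def power2_eq_square bichar_zero_left)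

text \<open>Orthogonality of characters: for \<open>g\<close> nonzero, a translation by some
  \<open>k\<close> multiplies the sum by a number other than 1.\<close>

lemma sum_bichar: "(\<Sum>h\<in>UNIV. bichar q g h) = (if g = 0 then of_nat CARD('g) else 0)"
proof (cases "g = 0")
  case True
  then show ?thesis by (simp add: bichar_zero_left)
next
  case False
  then obtain k where k: "bichar q g k \<noteq> 1" using mg unfolding metric_group_def by blast
  have "(\<Sum>h\<in>UNIV. bichar q g h) = (\<Sum>h\<in>UNIV. bichar q g (k + h))"
    by (rule sum.reindex_bij_witness[of _ "\<lambda>h. k + h" "\<lambda>h. h - k"]) auto
  also have "\<dots> = bichar q g k * (\<Sum>h\<in>UNIV. bichar q g h)"
    by (simp add: bichar_add_right sum_distrib_left)
  finally show ?thesis using k False by simp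
qed

text \<open>Completing the square: each summand is \<open>q (g + h) / q g\<close>, and a translation
  removes \<open>g\<close>.\<close>

lemma sum_bichar_metric_group:
  "(\<Sum>h\<in>UNIV. bichar q g h * q h) = (\<Sum>h\<in>UNIV. q h) / q g"
proof -
  have "(\<Sum>h\<in>UNIV. bichar q g h * q h) = (\<Sum>h\<in>UNIV. q (g + h) / q g)"
    by (rule sum.cong) (auto simp: bichar_def metric_group_nonzero field_simps)
  also have "\<dots> = (\<Sum>h\<in>UNIV. q h / q g)"
    by (rule sum.reindex_bij_witness[of _ "\<lambda>h. h - g" "\<lambda>h. g + h"]) auto
  finally show ?thesis by (simp add: sum_divide_distrib)
qed

text \<open>The product expands into four characters. The two deltas are kept separate because both
  hold when \<open>u = v\<close> is two-torsion.\<close>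

lemma sum_even_bichar:
  "(\<Sum>h\<in>UNIV. even_bichar q u h * even_bichar q v h)
   = 2 * of_nat CARD('g) * ((if u = v then 1 else 0) + (if u = - v then 1 else 0))"
proof -
  have "(\<Sum>h\<in>UNIV. even_bichar q u h * even_bichar q v h)
    = (\<Sum>h\<in>UNIV. bichar q (u + v) h + bichar q (u + - v) h
        + bichar q (- u + v) h + bichar q (- u + - v) h)"
    unfolding even_bichar_def bichar_add_left by (simp add: ring_distribs ac_simps)
  also have "\<dots> = 2 * of_nat CARD('g) * ((if u = v then 1 else 0) + (if u = - v then 1 else 0))"
  proof -
    have "u + v = 0 \<longleftrightarrow> u = - v" "u + - v = 0 \<longleftrightarrow> u = v"
      "- u + v = 0 \<longleftrightarrow> u = v" "- u + - v = 0 \<longleftrightarrow> u = - v"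
      by (auto simp: eq_neg_iff_add_eq_0 neg_eq_iff_add_eq_0 add.commute)
    then show ?thesis unfolding sum.distrib sum_bichar by (simp only:) simp
  qed
  finally show ?thesis .
qed

lemma sum_even_bichar_metric_group:
  "(\<Sum>h\<in>UNIV. even_bichar q u h * even_bichar q v h * q h)
   = 2 * (\<Sum>h\<in>UNIV. q h) * even_bichar q u v / (q u * q v)"
proof -
  let ?s = "\<Sum>h\<in>UNIV. q h"
  have "(\<Sum>h\<in>UNIV. even_bichar q u h * even_bichar q v h * q h)
    = (\<Sum>h\<in>UNIV. bichar q (u + v) h * q h + bichar q (u + - v) h * q h
        + bichar q (- u + v) h * q h + bichar q (- u + - v) h * q h)"
    unfolding even_bichar_def bichar_add_left by (simp add: ring_distribs ac_simps)
  also have "\<dots> = ?s / q (u + v) + ?s / q (u + - v) + ?s / q (- u + v) + ?s / q (- u + - v)"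
    unfolding sum.distrib sum_bichar_metric_group ..
  also have "\<dots> = 2 * ?s * even_bichar q u v / (q u * q v)"
    unfolding even_bichar_def metric_group_add bichar_minus_left bichar_minus_right metric_group_minus
    using metric_group_nonzero[of u] metric_group_nonzero[of v] bichar_nonzero[of u v]
    by (simp add: field_simps)
  finally show ?thesis .
qed

text \<open>Completing the square in reverse turns the squared modulus into a double sum of
  \<open>bichar q g h * q h\<close>; summing over \<open>g\<close> first leaves only
  \<open>h = 0\<close>.\<close>

lemma gauss_sum_cnj: "gauss_sum q * cnj (gauss_sum q) = 1"
proof -
  let ?s = "\<Sum>h\<in>UNIV. q h"
  have "?s * cnj ?s = (\<Sum>g\<in>UNIV. ?s / q g)"
    by (simp add: cnj_metric_group sum_distrib_left divide_inverse)
  also have "\<dots> = (\<Sum>g\<in>UNIV. \<Sum>h\<in>UNIV. bichar q g h * q h)"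
    by (simp add: sum_bichar_metric_group)
  also have "\<dots> = (\<Sum>h\<in>UNIV. \<Sum>g\<in>UNIV. bichar q h g * q h)"
    by (subst sum.swap) (simp add: bichar_commute)
  also have "\<dots> = (\<Sum>h\<in>UNIV. (if h = 0 then of_nat CARD('g) else 0) * q h)"
    by (simp only: sum_bichar flip: sum_distrib_right)
  also have "\<dots> = (\<Sum>h\<in>(UNIV::'g set). if h = 0 then of_nat CARD('g) else 0)"
    by (rule sum.cong) (auto simp: metric_group_zero)
  also have "\<dots> = of_nat CARD('g)"
    by simp
  finally have "?s * cnj ?s = of_nat CARD('g)" .
  then have "gauss_sum q * cnj (gauss_sum q) = a * a * of_nat CARD('g)"
    if "a = 1 / complex_of_real (sqrt (real CARD('g)))" for a
    using that by (simp add: gauss_sum_def)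
  from this[OF refl] show ?thesis by (simp only: gauss_sum_normalization)
qed

end

section \<open>Natural multiples, and Gauss sums of groups of odd order\<close>

primrec nsmul :: "nat \<Rightarrow> 'a::monoid_add \<Rightarrow> 'a" where
  "nsmul 0 x = 0"
| "nsmul (Suc n) x = x + nsmul n x"

lemma nsmul_add: "nsmul (m + n) x = nsmul m x + nsmul n x"
  by (induction m) (simp_all add: add.assoc)

lemma nsmul_zero: "nsmul n 0 = 0"
  by (induction n) simp_all

lemma nsmul_mult: "nsmul (m * n) x = nsmul m (nsmul n x)"
  by (induction m) (simp_all add: nsmul_add)

lemma nsmul_add_right: "nsmul n (x + y :: 'a::comm_monoid_add) = nsmul n x + nsmul n y"
  by (induction n) (simp_all add: ac_simps)

lemma nsmul_minus: "nsmul n (- x :: 'a::ab_group_add) = - nsmul n x"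
  by (induction n) (simp_all add: algebra_simps)

lemma nsmul_diff_right: "nsmul n (x - y :: 'a::ab_group_add) = nsmul n x - nsmul n y"
  using nsmul_add_right[of n x "- y"] by (simp add: nsmul_minus)

lemma sum_constant_nsmul: "finite A \<Longrightarrow> (\<Sum>i\<in>A. x) = nsmul (card A) x"
  by (induction A rule: finite_induct) simp_all

text \<open>Translating by \<open>x\<close> permutes the group but adds \<open>CARD('g)\<close>
  copies of \<open>x\<close> to the sum of all elements.\<close>

lemma nsmul_card:
  fixes x :: "'g::{finite, ab_group_add}"
  shows "nsmul CARD('g) x = 0"
proof -
  have "(\<Sum>y\<in>UNIV. y) = (\<Sum>y\<in>UNIV. x + y)"
    by (rule sum.reindex_bij_witness[of _ "\<lambda>y. x + y" "\<lambda>y. y - x"]) auto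
  also have "\<dots> = nsmul CARD('g) x + (\<Sum>y\<in>UNIV. y)"
    by (simp add: sum.distrib sum_constant_nsmul)
  finally show ?thesis by simp
qed

lemma bichar_nsmul_left:
  assumes "metric_group q"
  shows "bichar q (nsmul n g) h = bichar q g h ^ n"
  by (induction n) (simp_all add: bichar_zero_left[OF assms] bichar_add_left[OF assms])

lemma bichar_nsmul_right:
  assumes "metric_group q"
  shows "bichar q g (nsmul n h) = bichar q g h ^ n"
  by (induction n) (simp_all add: bichar_zero_right[OF assms] bichar_add_right[OF assms])

lemma metric_group_nsmul:
  assumes "metric_group q"
  shows "q (nsmul n g) = q g ^ (n\<^sup>2)"
proof (induction n)
  case (Suc n)
  have "(Suc n)\<^sup>2 = 1 + n\<^sup>2 + 2 * n" by (simp add: power2_eq_square)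
  moreover have "q (nsmul (Suc n) g) = q g * q g ^ (n\<^sup>2) * bichar q g g ^ n"
    using Suc by (simp add: metric_group_add[OF assms] bichar_nsmul_right[OF assms])
  ultimately show ?case
    by (simp add: bichar_self[OF assms] power_add power_mult)
qed (simp add: metric_group_zero[OF assms])

lemma power_odd_unipotent:
  fixes z :: "'a::idom"
  assumes "z\<^sup>2 = 1" "z ^ n = 1" "odd n"
  shows "z = 1"
  using assms by (auto simp: power2_eq_1_iff)

text \<open>Since \<open>-1 = u\<^sup>2 + v\<^sup>2\<close> modulo the exponent, the matrix with rows \<open>(u, -v)\<close> and \<open>(v, u)\<close>
  transports \<open>q \<oplus> q\<close> to its conjugate, so the square of the Gauss sum is real.\<close>

lemma gauss_sum_power4:
  fixes q :: "'g::{finite, ab_group_add} \<Rightarrow> complex"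
  assumes mg: "metric_group q" and odd: "odd CARD('g)"
  shows "gauss_sum q ^ 4 = 1"
proof -
  let ?s = "\<Sum>g\<in>UNIV. q g" and ?n = "CARD('g)"
  obtain u v where uv: "?n dvd u\<^sup>2 + v\<^sup>2 + 1"
    using odd_dvd_sum_two_squares_plus_one[OF odd] by auto
  then have ann: "nsmul (u\<^sup>2 + v\<^sup>2 + 1) x = 0" for x :: 'g
    by (metis dvd_def mult.commute nsmul_card nsmul_mult nsmul_zero)
  have inv: "q x ^ (u\<^sup>2 + v\<^sup>2) = inverse (q x)" for x
  proof -
    have "q x ^ (u\<^sup>2 + v\<^sup>2 + 1) = 1"
    \<comment> \<open>Annihilation by \<open>u\<^sup>2 + v\<^sup>2 + 1\<close> controls only
      \<open>bichar q x x\<close>, which is the square of \<open>q x\<close>. The remaining sign is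
      excluded because \<open>q x\<close> has odd order.\<close>
    proof (rule power_odd_unipotent)
      show "(q x ^ (u\<^sup>2 + v\<^sup>2 + 1))\<^sup>2 = 1"
        using bichar_nsmul_left[OF mg, of "u\<^sup>2 + v\<^sup>2 + 1" x x] ann[of x]
        unfolding bichar_self[OF mg] bichar_zero_left[OF mg] power_mult[symmetric]
        by (metis bichar_zero_left[OF mg] mult.commute)
      have "q x ^ (?n\<^sup>2) = 1"
        using metric_group_nsmul[OF mg, of ?n x] by (simp add: nsmul_card metric_group_zero[OF mg])
      then show "(q x ^ (u\<^sup>2 + v\<^sup>2 + 1)) ^ (?n\<^sup>2) = 1"
        by (metis mult.commute power_mult power_one)
      show "odd (?n\<^sup>2)" using odd by simp
    qed
    then show ?thesis using metric_group_nonzero[OF mg, of x] by (simp add: field_simps)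
  qed
  define F :: "'g \<times> 'g \<Rightarrow> 'g \<times> 'g" where
    "F = (\<lambda>(x, y). (nsmul u x - nsmul v y, nsmul v x + nsmul u y))"
  \<comment> \<open>The matrix has determinant \<open>u\<^sup>2 + v\<^sup>2\<close>, which acts as
    \<open>-1\<close>; hence its inverse is minus its adjugate.\<close>
  have "inj F"
  proof (rule inj_on_inverseI)
    fix z :: "'g \<times> 'g"
    obtain x y where z: "z = (x, y)" by (cases z)
    have sq: "nsmul (u * u) w + nsmul (v * v) w = - w" for w :: 'g
      using ann[of w] by (simp add: nsmul_add power2_eq_square eq_neg_iff_add_eq_0 ac_simps)
    have "nsmul u (nsmul u x - nsmul v y) + nsmul v (nsmul v x + nsmul u y) = - x"
      using sq[of x] by (simp add: nsmul_diff_right nsmul_add_right mult.commute[of v u]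
          flip: nsmul_mult)
    moreover have "nsmul u (nsmul v x + nsmul u y) - nsmul v (nsmul u x - nsmul v y) = - y"
      using sq[of y] by (simp add: nsmul_diff_right nsmul_add_right mult.commute[of v u]
          algebra_simps flip: nsmul_mult)
    ultimately show "(\<lambda>(r, s). (- (nsmul u r + nsmul v s), - (nsmul u s - nsmul v r))) (F z) = z"
      by (simp only: F_def z prod.case minus_minus)
  qed
  then have bij: "bij F" by (simp add: finite_UNIV_inj_surj bij_def)
  have qF: "q (fst (F z)) * q (snd (F z)) = cnj (q (fst z)) * cnj (q (snd z))" for z
  proof -
    obtain x y where z: "z = (x, y)" by (cases z)
    \<comment> \<open>The cross terms are \<open>bichar q x y ^ (u * v)\<close> and its inverse, and
      cancel.\<close>
    have "q (nsmul u x - nsmul v y) * q (nsmul v x + nsmul u y)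
        = q x ^ (u\<^sup>2) * q y ^ (v\<^sup>2) * (q x ^ (v\<^sup>2) * q y ^ (u\<^sup>2))"
      unfolding metric_group_add[OF mg] metric_group_diff[OF mg] metric_group_nsmul[OF mg]
        bichar_nsmul_left[OF mg] bichar_nsmul_right[OF mg]
      by (simp add: bichar_nonzero[OF mg] mult.commute[of v u] field_simps flip: power_mult)
    also have "\<dots> = q x ^ (u\<^sup>2 + v\<^sup>2) * q y ^ (u\<^sup>2 + v\<^sup>2)"
      by (simp add: power_add)
    finally show ?thesis by (simp add: z F_def inv cnj_metric_group[OF mg])
  qed
  have sq: "s * s = (\<Sum>z\<in>UNIV. f (fst z) * f (snd z))"
    if "s = (\<Sum>g\<in>UNIV. f g)" for s and f :: "'g \<Rightarrow> complex"
    unfolding that sum_product sum.cartesian_product UNIV_Times_UNIV by (simp add: case_prod_beta)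
  have "?s * ?s = (\<Sum>z\<in>UNIV. q (fst (F z)) * q (snd (F z)))"
    unfolding sq[OF refl] by (rule sum.reindex_bij_betw[OF bij, symmetric])
  also have "\<dots> = (\<Sum>z\<in>UNIV. cnj (q (fst z)) * cnj (q (snd z)))"
    by (simp add: qF)
  also have "\<dots> = cnj ?s * cnj ?s"
    by (rule sq[symmetric]) simp
  \<comment> \<open>With the square real, the fourth power is the squared modulus of the square,
    which is 1.\<close>
  finally have "gauss_sum q * gauss_sum q = cnj (gauss_sum q) * cnj (gauss_sum q)"
    by (simp add: gauss_sum_def)
  then have "gauss_sum q ^ 4
      = (gauss_sum q * cnj (gauss_sum q)) * (gauss_sum q * cnj (gauss_sum q))"
    by (simp add: eval_nat_numeral)
  then show ?thesis by (simp add: gauss_sum_cnj[OF mg])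
qed

section \<open>Summation over the index set\<close>

lemma sum_half_system:
  fixes f :: "'g::{finite, ab_group_add} \<Rightarrow> complex"
  assumes "half_system K H" and even: "\<And>g. f (- g) = f g"
  shows "sum f UNIV = sum f K + 2 * sum f H"
proof -
  have UN: "UNIV = K \<union> H \<union> uminus ` H" and disj: "K \<inter> H = {}" "(K \<union> H) \<inter> uminus ` H = {}"
    using assms(1) unfolding half_system_def by auto
  have "sum f UNIV = sum f (K \<union> H) + sum f (uminus ` H)"
    unfolding UN by (rule sum.union_disjoint) (use disj in auto)
  also have "sum f (K \<union> H) = sum f K + sum f H"
    by (rule sum.union_disjoint) (use disj in auto)
  also have "sum f (uminus ` H) = sum f H"
    by (subst sum.reindex) (auto simp: even inj_on_def)
  finally show ?thesis by simp
qed

lemma finite_idx_set: "finite (idx_set (Gs :: 'g::{finite, ab_group_add} set) (\<Gamma>s :: 'h::finite set))"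
proof -
  have eq: "{I_K k \<epsilon> | k \<epsilon>. k \<in> two_torsion - {0 :: 'g} \<and> \<epsilon> \<in> {1, - 1}}
      = (\<lambda>(k, \<epsilon>). I_K k \<epsilon>) ` ((two_torsion - {0}) \<times> {1, - 1})"
    by auto
  have "finite {I_K k \<epsilon> | k \<epsilon>. k \<in> two_torsion - {0 :: 'g} \<and> \<epsilon> \<in> {1, - 1}}"
    unfolding eq by (intro finite_imageI finite_SigmaI) auto
  then show ?thesis
    unfolding idx_set_def by (intro finite_UnI finite_imageI) auto
qed

lemma sum_idx_set:
  fixes F :: "('g::{finite, ab_group_add}, 'h::finite) idx \<Rightarrow> complex"
  shows "sum F (idx_set Gs \<Gamma>s) = F I_zero + F I_pi
    + (\<Sum>k\<in>two_torsion - {0}. F (I_K k 1) + F (I_K k (- 1)))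
    + (\<Sum>g\<in>Gs. F (I_G g)) + (\<Sum>\<gamma>\<in>\<Gamma>s. F (I_\<Gamma> \<gamma>))"
proof -
  let ?K = "two_torsion - {0 :: 'g}"
  let ?f = "\<lambda>(k, \<epsilon>). I_K k \<epsilon> :: ('g, 'h) idx"
  define X0 X1 X2 X3 :: "('g, 'h) idx set" where X: "X0 = {I_zero, I_pi}" "X1 = ?f ` (?K \<times> {1, - 1})"
    "X2 = I_G ` Gs" "X3 = I_\<Gamma> ` \<Gamma>s"
  have J: "idx_set Gs \<Gamma>s = X0 \<union> X1 \<union> X2 \<union> X3"
    by (auto simp: idx_set_def X)
  have "finite X0" "finite X1" "finite X2" "finite X3"
    and "X0 \<inter> X1 = {}" "X0 \<inter> X2 = {}" "X0 \<inter> X3 = {}" "X1 \<inter> X2 = {}" "X1 \<inter> X3 = {}" "X2 \<inter> X3 = {}"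
    by (auto simp: X)
  then have "sum F (idx_set Gs \<Gamma>s) = sum F X0 + sum F X1 + sum F X2 + sum F X3"
    unfolding J by (simp add: sum.union_disjoint Int_Un_distrib2)
  moreover have "sum F X1 = (\<Sum>k\<in>?K. F (I_K k 1) + F (I_K k (- 1)))"
  proof -
    have "sum F X1 = (\<Sum>(k, \<epsilon>)\<in>?K \<times> {1, - 1}. F (I_K k \<epsilon>))"
      unfolding X by (subst sum.reindex) (auto simp: inj_on_def case_prod_beta)
    then show ?thesis by (simp flip: sum.cartesian_product)
  qed
  moreover have "sum F X2 = (\<Sum>g\<in>Gs. F (I_G g))" "sum F X3 = (\<Sum>\<gamma>\<in>\<Gamma>s. F (I_\<Gamma> \<gamma>))"
    unfolding X by (simp_all add: sum.reindex inj_on_def)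
  moreover have "sum F X0 = F I_zero + F I_pi" by (simp add: X)
  ultimately show ?thesis by simp
qed

text \<open>
  The entry \<open>S' x y\<close> pairs the even functions \<open>G_weight x * (\<delta>(g) + \<delta>(-g))\<close> on \<open>G\<close> and
  \<open>\<Gamma>_weight x * (\<delta>(h) + \<delta>(-h))\<close> on \<open>\<Gamma>\<close>, where \<open>g = G_point x\<close> and \<open>h = \<Gamma>_point x\<close>, and the
  function \<open>K_sign x\<close> with their analogues for \<open>y\<close>. Elements of \<open>K\<close> are their own negatives,
  whence the weights \<open>1/2\<close>.
\<close>

fun G_weight :: "('g, 'h) idx \<Rightarrow> complex" where
  "G_weight I_zero = - 1 / 2"
| "G_weight I_pi = 1 / 2"
| "G_weight (I_K k \<epsilon>) = 1 / 2"
| "G_weight (I_G g) = 1"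
| "G_weight (I_\<Gamma> \<gamma>) = 0"

fun G_point :: "('g::zero, 'h) idx \<Rightarrow> 'g" where
  "G_point (I_K k \<epsilon>) = k"
| "G_point (I_G g) = g"
| "G_point x = 0"

fun \<Gamma>_weight :: "('g, 'h) idx \<Rightarrow> complex" where
  "\<Gamma>_weight I_zero = 1 / 2"
| "\<Gamma>_weight I_pi = 1 / 2"
| "\<Gamma>_weight (I_K k \<epsilon>) = 0"
| "\<Gamma>_weight (I_G g) = 0"
| "\<Gamma>_weight (I_\<Gamma> \<gamma>) = 1"

fun \<Gamma>_point :: "('g, 'h::zero) idx \<Rightarrow> 'h" where
  "\<Gamma>_point (I_\<Gamma> \<gamma>) = \<gamma>"
| "\<Gamma>_point x = 0"

fun K_sign :: "('g, 'h) idx \<Rightarrow> 'g \<Rightarrow> complex" where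
  "K_sign (I_K k \<epsilon>) l = (if k = l then \<epsilon> else 0)"
| "K_sign x l = 0"

text \<open>For even \<open>A\<close> and \<open>B\<close> this is half the pairing of
  \<open>(A, B, D)\<close> with the vector attached to \<open>z\<close>. The two deltas of an even
  vector contribute equally, so the factor \<open>1 / 2\<close> survives only in the last
  term.\<close>

definition idx_pairing ::
    "('g::{finite, zero} \<Rightarrow> complex) \<Rightarrow> ('h::zero \<Rightarrow> complex) \<Rightarrow> ('g \<Rightarrow> complex)
      \<Rightarrow> ('g, 'h) idx \<Rightarrow> complex" where
  "idx_pairing A B D z = G_weight z * A (G_point z) + \<Gamma>_weight z * B (\<Gamma>_point z)
     + (\<Sum>l\<in>UNIV. D l * K_sign z l) / 2"

lemma sum_K_sign:
  fixes E :: "'g::finite \<Rightarrow> complex"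
  shows "(\<Sum>l\<in>UNIV. E l * K_sign (I_K k \<epsilon>) l) = E k * \<epsilon>"
  using sum.delta'[of UNIV k "\<lambda>l. E l * \<epsilon>"] by (simp add: if_distrib cong: if_cong)

lemma idx_pairing_simps:
  "idx_pairing A B D I_zero = (B 0 - A 0) / 2"
  "idx_pairing A B D I_pi = (A 0 + B 0) / 2"
  "idx_pairing A B D (I_K k \<epsilon>) = (A k + D k * \<epsilon>) / 2"
  "idx_pairing A B D (I_G g) = A g"
  "idx_pairing A B D (I_\<Gamma> \<gamma>) = B \<gamma>"
  unfolding idx_pairing_def sum_K_sign by (simp_all add: field_simps)

text \<open>A Parseval identity. The elements of \<open>Gs\<close> and \<open>\<Gamma>s\<close>
  represent half of the non-fixed points, while the fixed points are covered by the pairs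
  \<open>I_zero\<close>, \<open>I_pi\<close> and \<open>I_K k 1\<close>,
  \<open>I_K k (- 1)\<close>.\<close>

lemma sum_idx_pairing:
  fixes A A' D D' w1 :: "'g::{finite, ab_group_add} \<Rightarrow> complex"
    and B B' w2 :: "'h::{finite, ab_group_add} \<Rightarrow> complex"
  assumes half: "half_system two_torsion Gs" "half_system {0} \<Gamma>s"
    and even: "\<And>g. A (- g) = A g" "\<And>g. A' (- g) = A' g" "\<And>g. w1 (- g) = w1 g"
      "\<And>h. B (- h) = B h" "\<And>h. B' (- h) = B' h" "\<And>h. w2 (- h) = w2 h"
    and zero: "w1 0 = 1" "w2 0 = 1"
    and supp: "\<And>l. l \<notin> two_torsion - {0} \<Longrightarrow> D l = 0"
  shows "(\<Sum>z\<in>idx_set Gs \<Gamma>s. idx_pairing A B D z * T_diag w1 w2 z * idx_pairing A' B' D' z)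
    = ((\<Sum>g\<in>UNIV. A g * A' g * w1 g) + (\<Sum>h\<in>UNIV. B h * B' h * w2 h)
       + (\<Sum>l\<in>UNIV. D l * D' l * w1 l)) / 2"
proof -
  let ?K = "two_torsion - {0 :: 'g}"
  \<comment> \<open>Each pair has the form \<open>(X + Y) / 2\<close>, \<open>(X - Y) / 2\<close> up
    to sign, so the mixed terms in \<open>A\<close>, \<open>B\<close> and in \<open>A\<close>,
    \<open>D\<close> cancel.\<close>
  have J: "(\<Sum>z\<in>idx_set Gs \<Gamma>s. idx_pairing A B D z * T_diag w1 w2 z * idx_pairing A' B' D' z)
    = (A 0 * A' 0 + B 0 * B' 0) / 2 + (\<Sum>k\<in>?K. (A k * A' k * w1 k + D k * D' k * w1 k) / 2)
      + (\<Sum>g\<in>Gs. A g * A' g * w1 g) + (\<Sum>\<gamma>\<in>\<Gamma>s. B \<gamma> * B' \<gamma> * w2 \<gamma>)"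
    unfolding sum_idx_set
    by (simp add: idx_pairing_simps zero field_simps) (rule sum.cong, simp_all add: field_simps)
  have G: "(\<Sum>g\<in>UNIV. A g * A' g * w1 g)
      = A 0 * A' 0 + (\<Sum>k\<in>?K. A k * A' k * w1 k) + 2 * (\<Sum>g\<in>Gs. A g * A' g * w1 g)"
  proof -
    have "(\<Sum>g\<in>UNIV. A g * A' g * w1 g)
        = (\<Sum>g\<in>two_torsion. A g * A' g * w1 g) + 2 * (\<Sum>g\<in>Gs. A g * A' g * w1 g)"
      by (rule sum_half_system[OF half(1)]) (simp add: even)
    moreover have "(0 :: 'g) \<in> two_torsion" by (simp add: two_torsion_def)
    ultimately show ?thesis by (simp add: sum.remove zero)
  qed
  have \<Gamma>: "(\<Sum>h\<in>UNIV. B h * B' h * w2 h) = B 0 * B' 0 + 2 * (\<Sum>\<gamma>\<in>\<Gamma>s. B \<gamma> * B' \<gamma> * w2 \<gamma>)"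
    using sum_half_system[OF half(2), of "\<lambda>h. B h * B' h * w2 h"] by (simp add: even zero)
  have D: "(\<Sum>l\<in>UNIV. D l * D' l * w1 l) = (\<Sum>k\<in>?K. D k * D' k * w1 k)"
    by (rule sum.mono_neutral_right) (auto simp: supp)
  show ?thesis
    unfolding J G \<Gamma> D sum_divide_distrib[symmetric] sum.distrib by (simp add: field_simps)
qed

section \<open>The modular relations\<close>

context
  fixes q :: "'g::{finite, ab_group_add} \<Rightarrow> complex"
  assumes mg: "metric_group q"
begin

lemma even_bichar_commute: "even_bichar q u v = even_bichar q v u"
  unfolding even_bichar_def bichar_minus_left[OF mg] by (simp add: bichar_commute[OF mg])

lemma even_bichar_minus: "even_bichar q u (- h) = even_bichar q u h"
  by (simp add: even_bichar_def bichar_minus_left[OF mg] bichar_minus_right[OF mg])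

text \<open>Orthogonality and completing the square, rescaled for two rows of weights
  \<open>s\<close> and \<open>t\<close>. The first sum serves \<open>S'^2\<close>, the second
  \<open>S' T' S'\<close>.\<close>

lemma sum_even_bichar_kernel:
  fixes s t :: complex
  defines "a \<equiv> 1 / complex_of_real (sqrt (real CARD('g)))"
  shows "(\<Sum>h\<in>UNIV. (a * s * even_bichar q u h) * (a * t * even_bichar q v h))
      = 2 * s * t * ((if u = v then 1 else 0) + (if u = - v then 1 else 0))"
    and "(\<Sum>h\<in>UNIV. (a * s * even_bichar q u h) * (a * t * even_bichar q v h) * q h)
      = 2 * gauss_sum q * a * s * t * even_bichar q u v / (q u * q v)"
proof -
  have "(\<Sum>h\<in>UNIV. (a * s * even_bichar q u h) * (a * t * even_bichar q v h))
      = a * a * (s * t) * (\<Sum>h\<in>UNIV. even_bichar q u h * even_bichar q v h)"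
    by (simp add: sum_distrib_left ac_simps)
  also have "\<dots> = a * a * of_nat CARD('g) * (2 * s * t)
      * ((if u = v then 1 else 0) + (if u = - v then 1 else 0))"
    unfolding sum_even_bichar[OF mg] by (simp only: ac_simps)
  finally show "(\<Sum>h\<in>UNIV. (a * s * even_bichar q u h) * (a * t * even_bichar q v h))
      = 2 * s * t * ((if u = v then 1 else 0) + (if u = - v then 1 else 0))"
    unfolding a_def gauss_sum_normalization by simp
  have "(\<Sum>h\<in>UNIV. (a * s * even_bichar q u h) * (a * t * even_bichar q v h) * q h)
      = a * a * (s * t) * (\<Sum>h\<in>UNIV. even_bichar q u h * even_bichar q v h * q h)"
    by (simp add: sum_distrib_left ac_simps)
  also have "\<dots> = 2 * (a * (\<Sum>h\<in>UNIV. q h)) * a * s * t * even_bichar q u v / (q u * q v)"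
    unfolding sum_even_bichar_metric_group[OF mg] by simp
  finally show "(\<Sum>h\<in>UNIV. (a * s * even_bichar q u h) * (a * t * even_bichar q v h) * q h)
      = 2 * gauss_sum q * a * s * t * even_bichar q u v / (q u * q v)"
    unfolding a_def gauss_sum_normalization .
qed

end

section \<open>Two-torsion elements and the rows of \<open>S'\<close>\<close>

lemma even_bichar_two_torsion:
  assumes "metric_group q" "k \<in> two_torsion"
  shows "even_bichar q k h = 2 * bichar q k h" "even_bichar q h k = 2 * bichar q h k"
proof -
  have "- k = k" using assms(2) by (simp add: two_torsion_def eq_neg_iff_add_eq_0 neg_eq_iff_add_eq_0)
  then show "even_bichar q k h = 2 * bichar q k h" by (simp add: even_bichar_def)
  then show "even_bichar q h k = 2 * bichar q h k"
    using even_bichar_commute[OF assms(1)] bichar_commute[OF assms(1)] by metis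
qed

lemma even_bichar_zero:
  assumes "metric_group q"
  shows "even_bichar q 0 h = 2" "even_bichar q h 0 = 2"
  by (simp_all add: even_bichar_def bichar_zero_left[OF assms] bichar_zero_right[OF assms])

text \<open>The fourth power of \<open>q k\<close> is the square of \<open>bichar q k k\<close>, and
  \<open>k\<close> is two-torsion.\<close>

lemma two_torsion_power4:
  assumes "metric_group q" "k \<in> two_torsion"
  shows "q k ^ 4 = 1"
  using bichar_two_torsion[OF assms, of k]
  by (simp add: bichar_self[OF assms(1)] flip: power_mult)

lemma K_sign_outside:
  "x \<in> idx_set Gs \<Gamma>s \<Longrightarrow> l \<notin> two_torsion - {0} \<Longrightarrow> K_sign x l = 0"
  by (cases x) (auto simp: idx_set_def)

text \<open>A check of all blocks. The sign before \<open>G_weight\<close> is the minus sign of the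
  Weil representation of \<open>G\<close>; at two-torsion points \<open>even_bichar\<close> doubles
  the character, which offsets a weight \<open>1 / 2\<close>.\<close>

lemma S_mat_eq_idx_pairing:
  fixes q1 :: "'g::{finite, ab_group_add} \<Rightarrow> complex"
    and q2 :: "'h::{finite, ab_group_add} \<Rightarrow> complex"
  assumes mg: "metric_group q1" "metric_group q2"
    and J: "x \<in> idx_set Gs \<Gamma>s" "y \<in> idx_set Gs \<Gamma>s"
  defines "a \<equiv> 1 / complex_of_real (sqrt (real CARD('g)))"
    and "b \<equiv> 1 / complex_of_real (sqrt (real CARD('h)))"
  shows "S_mat q1 q2 c x y = idx_pairing
      (\<lambda>g. a * (- G_weight x) * even_bichar q1 (G_point x) g)
      (\<lambda>h. b * \<Gamma>_weight x * even_bichar q2 (\<Gamma>_point x) h)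
      (\<lambda>l. - c * q1 l * K_sign x l) y"
proof -
  have K: "k \<in> two_torsion" if "I_K k \<epsilon> \<in> idx_set Gs \<Gamma>s" for k :: 'g and \<epsilon>
    using that by (auto simp: idx_set_def)
  note ev = even_bichar_zero[OF mg(1)] even_bichar_zero[OF mg(2)]
    even_bichar_two_torsion[OF mg(1) K] bichar_zero_right[OF mg(1)]
  show ?thesis
    using J by (cases x; cases y)
      (simp_all add: S_mat_def Let_def ev idx_pairing_simps a_def[symmetric] b_def[symmetric],
       simp_all add: even_bichar_def cnj_bichar[OF mg(1)] cnj_bichar[OF mg(2)] field_simps)
qed

lemma S_mat_commute:
  assumes "metric_group q1" "metric_group q2"
  shows "S_mat q1 q2 c x y = S_mat q1 q2 c y x"
  by (cases x; cases y) (auto simp: S_mat_def Let_def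
      bichar_commute[OF assms(1)] bichar_commute[OF assms(2)])

section \<open>The products \<open>S'^2\<close> and \<open>S' T' S'\<close>\<close>

context
  fixes q1 :: "'g::{finite, ab_group_add} \<Rightarrow> complex"
    and q2 :: "'h::{finite, ab_group_add} \<Rightarrow> complex"
    and Gs :: "'g set" and \<Gamma>s :: "'h set" and c :: complex
  assumes mg: "metric_group q1" "metric_group q2"
    and c_power4: "c ^ 4 = 1"
    and gauss: "gauss_sum q1 = c" "gauss_sum q2 = - c"
    and half: "half_system two_torsion Gs" "half_system {0} \<Gamma>s"
begin

text \<open>Both products at once: constant weights 1 give \<open>S'^2\<close>, the weights
  \<open>q1\<close>, \<open>q2\<close> give \<open>S' T' S'\<close>. Symmetry of \<open>S'\<close>
  turns the column of \<open>y\<close> into a row.\<close>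

lemma sum_S_mat_diag:
  fixes w1 :: "'g \<Rightarrow> complex" and w2 :: "'h \<Rightarrow> complex"
  defines "a \<equiv> 1 / complex_of_real (sqrt (real CARD('g)))"
    and "b \<equiv> 1 / complex_of_real (sqrt (real CARD('h)))"
  assumes J: "x \<in> idx_set Gs \<Gamma>s" "y \<in> idx_set Gs \<Gamma>s"
    and w: "\<And>g. w1 (- g) = w1 g" "\<And>h. w2 (- h) = w2 h" "w1 0 = 1" "w2 0 = 1"
  shows "(\<Sum>z\<in>idx_set Gs \<Gamma>s. S_mat q1 q2 c x z * T_diag w1 w2 z * S_mat q1 q2 c z y)
    = ((\<Sum>g\<in>UNIV. (a * (- G_weight x) * even_bichar q1 (G_point x) g)
            * (a * (- G_weight y) * even_bichar q1 (G_point y) g) * w1 g)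
       + (\<Sum>h\<in>UNIV. (b * \<Gamma>_weight x * even_bichar q2 (\<Gamma>_point x) h)
            * (b * \<Gamma>_weight y * even_bichar q2 (\<Gamma>_point y) h) * w2 h)
       + c\<^sup>2 * (\<Sum>l\<in>UNIV. (q1 l)\<^sup>2 * w1 l * K_sign x l * K_sign y l)) / 2"
proof -
  let ?A = "\<lambda>x g. a * (- G_weight x) * even_bichar q1 (G_point x) g"
  let ?B = "\<lambda>x h. b * \<Gamma>_weight x * even_bichar q2 (\<Gamma>_point x) h"
  let ?D = "\<lambda>x l. - c * q1 l * K_sign x l"
  have "(\<Sum>z\<in>idx_set Gs \<Gamma>s. S_mat q1 q2 c x z * T_diag w1 w2 z * S_mat q1 q2 c z y)
    = (\<Sum>z\<in>idx_set Gs \<Gamma>s. idx_pairing (?A x) (?B x) (?D x) z * T_diag w1 w2 z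
        * idx_pairing (?A y) (?B y) (?D y) z)"
    unfolding S_mat_commute[OF mg, of c _ y] a_def b_def
    using S_mat_eq_idx_pairing[OF mg] J by (intro sum.cong) auto
  also have "\<dots> = ((\<Sum>g\<in>UNIV. ?A x g * ?A y g * w1 g) + (\<Sum>h\<in>UNIV. ?B x h * ?B y h * w2 h)
       + (\<Sum>l\<in>UNIV. ?D x l * ?D y l * w1 l)) / 2"
    using half
    by (rule sum_idx_pairing)
      (simp_all add: even_bichar_minus[OF mg(1)] even_bichar_minus[OF mg(2)] w K_sign_outside[OF J(1)])
  also have "(\<Sum>l\<in>UNIV. ?D x l * ?D y l * w1 l)
      = c\<^sup>2 * (\<Sum>l\<in>UNIV. (q1 l)\<^sup>2 * w1 l * K_sign x l * K_sign y l)"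
    by (simp add: sum_distrib_left power2_eq_square ac_simps)
  finally show ?thesis .
qed

lemma c_square: "c\<^sup>2 = 1 \<or> c\<^sup>2 = - 1"
  using c_power4 power2_eq_1_iff[of "c\<^sup>2"] by (simp flip: power_mult)

lemma idx_neg_cases:
  assumes "half_system K H" "g \<in> H" "g' \<in> H"
  shows "g \<noteq> - g'" "g \<notin> K" "- g \<notin> K"
  using assms unfolding half_system_def by (auto simp: disjoint_iff)

lemma S_mat_square:
  assumes J: "x \<in> idx_set Gs \<Gamma>s" "y \<in> idx_set Gs \<Gamma>s"
  shows "(\<Sum>z\<in>idx_set Gs \<Gamma>s. S_mat q1 q2 c x z * S_mat q1 q2 c z y) = C_mat q1 c x y"
proof -
  have T1: "T_diag (\<lambda>_. 1) (\<lambda>_. 1) z = 1" for z :: "('g, 'h) idx"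
    by (cases z) simp_all
  have "(\<Sum>z\<in>idx_set Gs \<Gamma>s. S_mat q1 q2 c x z * S_mat q1 q2 c z y)
      = G_weight x * G_weight y
          * ((if G_point x = G_point y then 1 else 0) + (if G_point x = - G_point y then 1 else 0))
        + \<Gamma>_weight x * \<Gamma>_weight y
          * ((if \<Gamma>_point x = \<Gamma>_point y then 1 else 0) + (if \<Gamma>_point x = - \<Gamma>_point y then 1 else 0))
        + c\<^sup>2 * (\<Sum>l\<in>UNIV. (q1 l)\<^sup>2 * K_sign x l * K_sign y l) / 2" (is "_ = ?r")
    using sum_S_mat_diag[OF J, of "\<lambda>_. 1" "\<lambda>_. 1"]
    unfolding T1 mult_1_right sum_even_bichar_kernel[OF mg(1)] sum_even_bichar_kernel[OF mg(2)]
    by (simp add: add_divide_distrib)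
  also have "?r = C_mat q1 c x y"
  proof -
    have mem: "I_K k \<epsilon> \<in> idx_set Gs \<Gamma>s \<longleftrightarrow> k \<in> two_torsion \<and> k \<noteq> 0 \<and> (\<epsilon> = 1 \<or> \<epsilon> = - 1)"
      "I_G g \<in> idx_set Gs \<Gamma>s \<longleftrightarrow> g \<in> Gs" "I_\<Gamma> h \<in> idx_set Gs \<Gamma>s \<longleftrightarrow> h \<in> \<Gamma>s" for k g \<epsilon> h
      by (auto simp: idx_set_def)
    have zero: "(0 :: 'g) \<in> two_torsion" by (simp add: two_torsion_def)
    have Gs: "g \<noteq> - g'" if "g \<in> Gs" "g' \<in> Gs" for g g'
      using idx_neg_cases[OF half(1) that] by simp
    have GK: "g \<noteq> 0" "k \<noteq> g" "g \<noteq> k" "k \<noteq> - g" "g \<noteq> - k"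
      if "k \<in> two_torsion" "g \<in> Gs" for k g
      using idx_neg_cases[OF half(1) that(2) that(2)] that(1) zero by (metis minus_minus)+
    have \<Gamma>s: "h \<noteq> - h'" if "h \<in> \<Gamma>s" "h' \<in> \<Gamma>s" for h h'
      using idx_neg_cases[OF half(2) that] by simp
    have \<Gamma>0: "h \<noteq> 0" if "h \<in> \<Gamma>s" for h
      using idx_neg_cases[OF half(2) that that] by simp
    have K: "- k = k" if "k \<in> two_torsion" for k :: 'g
      using that by (simp add: two_torsion_def eq_neg_iff_add_eq_0 neg_eq_iff_add_eq_0)
    \<comment> \<open>Here \<open>c ^ 4 = 1\<close> enters: it makes the factor in the involution a
      genuine sign.\<close>
    have sign: "c\<^sup>2 * (q1 k)\<^sup>2 = 1 \<or> c\<^sup>2 * (q1 k)\<^sup>2 = - 1" if "k \<in> two_torsion" for k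
      using c_square two_torsion_power4[OF mg(1) that] power2_eq_1_iff[of "(q1 k)\<^sup>2"]
      by (auto simp flip: power_mult)
    show ?thesis
    proof (cases "\<exists>k \<epsilon> k' \<epsilon>'. x = I_K k \<epsilon> \<and> y = I_K k' \<epsilon>'")
      case True
      then obtain k \<epsilon> k' \<epsilon>' where xy: "x = I_K k \<epsilon>" "y = I_K k' \<epsilon>'" by auto
      then have k: "k \<in> two_torsion" "k' \<in> two_torsion"
        and \<epsilon>: "\<epsilon> = 1 \<or> \<epsilon> = - 1" "\<epsilon>' = 1 \<or> \<epsilon>' = - 1"
        using J by (auto simp: mem)
      show ?thesis
      proof (cases "k = k'")
        case True
        \<comment> \<open>Both deltas on \<open>G\<close> hold because \<open>k = - k\<close>, and
          \<open>1 / 4\<close> taken twice gives the first half.\<close>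
        have "?r = (1 + c\<^sup>2 * (q1 k')\<^sup>2 * \<epsilon> * \<epsilon>') / 2"
          unfolding xy sum_K_sign using True by (simp add: K[OF k(2)] add_divide_distrib)
        also have "\<dots> = (if \<epsilon> = c\<^sup>2 * (q1 k')\<^sup>2 * \<epsilon>' then 1 else 0)"
        proof -
          have "(1 + s * \<epsilon> * \<epsilon>') / 2 = (if \<epsilon> = s * \<epsilon>' then 1 else 0)"
            if "s = 1 \<or> s = - 1" for s
            using that \<epsilon> by (elim disjE) simp_all
          then show ?thesis using sign[OF k(2)] .
        qed
        also have "\<dots> = C_mat q1 c x y"
          unfolding xy C_mat_def using True by (simp add: bichar_self[OF mg(1)])
        finally show ?thesis .
      next
        case False
        then show ?thesis unfolding xy sum_K_sign by (simp add: K[OF k(2)] C_mat_def)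
      qed
    next
      \<comment> \<open>At least one \<open>K_sign\<close> vanishes, so only the deltas remain. For
        \<open>I_zero\<close> against \<open>I_pi\<close> the parts from \<open>G\<close> and
        \<open>\<Gamma>\<close> are \<open>- 1 / 2\<close> and \<open>1 / 2\<close>.\<close>
      case False
      then show ?thesis using J
        by (cases x; cases y)
          (simp_all add: C_mat_def mem GK GK[OF zero] Gs \<Gamma>s \<Gamma>0 GK[OF zero, symmetric] \<Gamma>0[symmetric])
    qed
  qed
  finally show ?thesis .
qed

lemma T_diag_nonzero: "T_diag q1 q2 x \<noteq> 0"
  by (cases x) (simp_all add: metric_group_nonzero[OF mg(1)] metric_group_nonzero[OF mg(2)])

text \<open>The Gauss sums \<open>c\<close> and \<open>- c\<close> have opposite signs, as do the
  two kernels in \<open>S'\<close>, so both parts acquire the same factor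
  \<open>- c\<close>.\<close>

lemma S_mat_T_diag_S_mat:
  assumes J: "x \<in> idx_set Gs \<Gamma>s" "y \<in> idx_set Gs \<Gamma>s"
  shows "(\<Sum>z\<in>idx_set Gs \<Gamma>s. S_mat q1 q2 c x z * T_diag q1 q2 z * S_mat q1 q2 c z y)
    = - c * S_mat q1 q2 c x y / (T_diag q1 q2 x * T_diag q1 q2 y)"
proof -
  define a where "a = 1 / complex_of_real (sqrt (real CARD('g)))"
  define b where "b = 1 / complex_of_real (sqrt (real CARD('h)))"
  let ?T = "T_diag q1 q2 x * T_diag q1 q2 y"
  \<comment> \<open>The two denominators can differ only at \<open>\<Gamma>\<close> indices, where
    the weight is 0.\<close>
  have G: "G_weight z / q1 (G_point z) = G_weight z / T_diag q1 q2 z" for z :: "('g, 'h) idx"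
    by (cases z) (simp_all add: metric_group_zero[OF mg(1)])
  have \<Gamma>: "\<Gamma>_weight z / q2 (\<Gamma>_point z) = \<Gamma>_weight z / T_diag q1 q2 z" for z :: "('g, 'h) idx"
    by (cases z) (simp_all add: metric_group_zero[OF mg(2)])
  \<comment> \<open>On the diagonal block \<open>q1 l ^ 4 = 1\<close> converts a cube into an
    inverse.\<close>
  have K: "(q1 l)\<^sup>2 * q1 l * K_sign x l * K_sign y l = q1 l * K_sign x l * K_sign y l / ?T" for l
  proof (cases "K_sign x l = 0 \<or> K_sign y l = 0")
    case False
    then obtain \<epsilon> \<epsilon>' where "x = I_K l \<epsilon>" "y = I_K l \<epsilon>'"
      by (cases x; cases y) (auto split: if_splits)
    moreover have "l \<in> two_torsion"
      using False K_sign_outside[OF J(1), of l] by blast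
    ultimately show ?thesis
      using two_torsion_power4[OF mg(1), of l] metric_group_nonzero[OF mg(1), of l]
      by (simp add: field_simps eval_nat_numeral)
  qed auto
  have "(\<Sum>z\<in>idx_set Gs \<Gamma>s. S_mat q1 q2 c x z * T_diag q1 q2 z * S_mat q1 q2 c z y)
      = c * a * (G_weight x / q1 (G_point x)) * (G_weight y / q1 (G_point y))
          * even_bichar q1 (G_point x) (G_point y)
        - c * b * (\<Gamma>_weight x / q2 (\<Gamma>_point x)) * (\<Gamma>_weight y / q2 (\<Gamma>_point y))
          * even_bichar q2 (\<Gamma>_point x) (\<Gamma>_point y)
        + c\<^sup>2 * (\<Sum>l\<in>UNIV. (q1 l)\<^sup>2 * q1 l * K_sign x l * K_sign y l) / 2"
    unfolding sum_S_mat_diag[OF J metric_group_minus[OF mg(1)] metric_group_minus[OF mg(2)]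
        metric_group_zero[OF mg(1)] metric_group_zero[OF mg(2)]]
      sum_even_bichar_kernel[OF mg(1)] sum_even_bichar_kernel[OF mg(2)] gauss
    unfolding a_def[symmetric] b_def[symmetric]
    by (simp add: field_simps)
  also have "\<dots> = - c * (- a * G_weight x * G_weight y * even_bichar q1 (G_point x) (G_point y)
        + b * \<Gamma>_weight x * \<Gamma>_weight y * even_bichar q2 (\<Gamma>_point x) (\<Gamma>_point y)
        - c * (\<Sum>l\<in>UNIV. q1 l * K_sign x l * K_sign y l) / 2) / ?T"
    unfolding G \<Gamma> K sum_divide_distrib[symmetric]
    using T_diag_nonzero[of x] T_diag_nonzero[of y]
    by (simp add: field_simps power2_eq_square)
  also have "(- a * G_weight x * G_weight y * even_bichar q1 (G_point x) (G_point y)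
        + b * \<Gamma>_weight x * \<Gamma>_weight y * even_bichar q2 (\<Gamma>_point x) (\<Gamma>_point y)
        - c * (\<Sum>l\<in>UNIV. q1 l * K_sign x l * K_sign y l) / 2) = S_mat q1 q2 c x y"
    unfolding S_mat_eq_idx_pairing[OF mg J] idx_pairing_def a_def[symmetric] b_def[symmetric]
    by (simp add: sum_distrib_left sum_negf ac_simps)
  finally show ?thesis .
qed

end

section \<open>From entrywise identities to the matrix relations\<close>

lemma T_diag_idx_bar: "T_diag q1 q2 (idx_bar q1 c x) = T_diag q1 q2 x"
  by (cases x) simp_all

theorem corollary7p2:
  fixes q1 :: "'g::{finite, ab_group_add} \<Rightarrow> complex"
    and q2 :: "'h::{finite, ab_group_add} \<Rightarrow> complex"
    and Gs :: "'g set" and \<Gamma>s :: "'h set" and c :: complex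
  assumes "metric_group q1" and "metric_group q2"
    and "even CARD('g)" and "odd CARD('h)"
    and "c = gauss_sum q1" and "c = - gauss_sum q2"
    and "half_system two_torsion Gs" and "half_system {0} \<Gamma>s"
  defines "J \<equiv> idx_set Gs \<Gamma>s"
    and "S \<equiv> S_mat q1 q2 c" and "T \<equiv> T_mat q1 q2" and "C \<equiv> C_mat q1 c"
  shows "mat_eq_on J (mat_power_on J S 2) C
       \<and> mat_eq_on J (mat_power_on J (mat_mult_on J S T) 3) (\<lambda>x y. - c * C x y)
       \<and> mat_eq_on J (mat_mult_on J T C) (mat_mult_on J C T)"
proof -
  \<comment> \<open>The odd group supplies this: its Gauss sum differs from \<open>c\<close> only by
    a sign.\<close>
  have c4: "c ^ 4 = 1"
    using gauss_sum_power4[OF assms(2,4)] assms(6) by simp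
  have gauss2: "gauss_sum q2 = - c" using assms(6) by simp
  note asms = assms(1,2) c4 assms(5)[symmetric] gauss2 assms(7,8)
  let ?t = "T_diag q1 q2"
  have fin: "finite J" unfolding J_def by (rule finite_idx_set)
  have SS: "(\<Sum>z\<in>J. S x z * S z y) = C x y" if "x \<in> J" "y \<in> J" for x y
    using S_mat_square[OF asms] that unfolding J_def S_def C_def by blast
  have STS: "(\<Sum>z\<in>J. S x z * ?t z * S z y) = - c * S x y / (?t x * ?t y)"
    if "x \<in> J" "y \<in> J" for x y
    using S_mat_T_diag_S_mat[OF asms] that unfolding J_def S_def by blast
  have t0: "?t x \<noteq> 0" for x
    by (rule T_diag_nonzero[OF asms])
  have Ct: "C x y * ?t y = ?t x * C x y" for x y
    by (simp add: C_def C_mat_def T_diag_idx_bar)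
  have AT: "mat_mult_on J A T x y = A x y * ?t y" if "y \<in> J" for A x y
  proof -
    have "mat_mult_on J A T x y = (\<Sum>z\<in>J. if z = y then A x z * ?t z else 0)"
      unfolding mat_mult_on_def by (rule sum.cong) (auto simp: T_def T_mat_def)
    then show ?thesis using that fin by simp
  qed
  have TA: "mat_mult_on J T A x y = ?t x * A x y" if "x \<in> J" for A x y
  proof -
    have "mat_mult_on J T A x y = (\<Sum>z\<in>J. if z = x then ?t z * A z y else 0)"
      unfolding mat_mult_on_def by (rule sum.cong) (auto simp: T_def T_mat_def)
    then show ?thesis using that fin by simp
  qed
  \<comment> \<open>Matrix powers start from the identity matrix; this removes that trailing
    factor.\<close>
  have A1: "mat_mult_on J A (\<lambda>x y. if x = y then 1 else 0) x y = A x y" if "y \<in> J" for A x y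
  proof -
    have "mat_mult_on J A (\<lambda>x y. if x = y then 1 else 0) x y = (\<Sum>z\<in>J. if z = y then A x z else 0)"
      unfolding mat_mult_on_def by (rule sum.cong) auto
    then show ?thesis using that fin by simp
  qed
  have "mat_eq_on J (mat_power_on J S 2) C"
    unfolding mat_eq_on_def
  proof (intro ballI)
    fix x y assume xy: "x \<in> J" "y \<in> J"
    have "mat_power_on J S 2 x y = (\<Sum>z\<in>J. S x z * mat_mult_on J S (\<lambda>x y. if x = y then 1 else 0) z y)"
      by (simp add: mat_power_on_def numeral_2_eq_2 mat_mult_on_def)
    then show "mat_power_on J S 2 x y = C x y" by (simp only: A1[OF xy(2)] SS[OF xy])
  qed
  moreover have "mat_eq_on J (mat_power_on J (mat_mult_on J S T) 3) (\<lambda>x y. - c * C x y)"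
    unfolding mat_eq_on_def
  proof (intro ballI)
    fix x y assume xy: "x \<in> J" "y \<in> J"
    have "mat_power_on J (mat_mult_on J S T) 3 x y
        = (\<Sum>z\<in>J. mat_mult_on J S T x z * (\<Sum>w\<in>J. mat_mult_on J S T z w
            * mat_mult_on J (mat_mult_on J S T) (\<lambda>x y. if x = y then 1 else 0) w y))"
      by (simp add: mat_power_on_def numeral_3_eq_3 mat_mult_on_def)
    also have "\<dots> = (\<Sum>z\<in>J. S x z * ?t z * (\<Sum>w\<in>J. S z w * ?t w * (S w y * ?t y)))"
      by (intro sum.cong refl) (simp add: A1[OF xy(2)] AT xy)
    \<comment> \<open>Regrouping as \<open>(S' T' S') T' S' T'\<close> and substituting for the
      bracket leaves \<open>- c T'^-1 S'^2 T'\<close>; finally \<open>T'\<close> commutes with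
      \<open>C'\<close>.\<close>
    also have "\<dots> = (\<Sum>w\<in>J. (\<Sum>z\<in>J. S x z * ?t z * S z w) * ?t w * (S w y * ?t y))"
      unfolding sum_distrib_left sum_distrib_right
      by (subst sum.swap) (simp add: ac_simps)
    also have "\<dots> = (\<Sum>w\<in>J. - c / ?t x * (S x w * S w y) * ?t y)"
    proof (intro sum.cong refl)
      fix w assume "w \<in> J"
      then show "(\<Sum>z\<in>J. S x z * ?t z * S z w) * ?t w * (S w y * ?t y)
          = - c / ?t x * (S x w * S w y) * ?t y"
        unfolding STS[OF xy(1) \<open>w \<in> J\<close>] using t0[of w] by simp
    qed
    also have "\<dots> = - c / ?t x * C x y * ?t y"
      by (simp only: SS[OF xy] flip: sum_distrib_left sum_distrib_right)
    also have "\<dots> = - c * C x y"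
      using t0[of x] by (simp add: Ct mult.assoc)
    finally show "mat_power_on J (mat_mult_on J S T) 3 x y = - c * C x y" .
  qed
  moreover have "mat_eq_on J (mat_mult_on J T C) (mat_mult_on J C T)"
    by (simp add: mat_eq_on_def AT TA Ct)
  ultimately show ?thesis by blast
qed

end
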